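(* Assume that $2^\omega$ (the Cantor space) is not the union of fewer than $2^{\aleph_0}$ meager sets. Then there exist sets of reals $X_1, X_2$, each satisfying $\mathsf{S}_1(\Omega,\Omega)$, such that $X_1\cup X_2$ does not satisfy $\mathsf{U}_{fin}(\Gamma,\Omega)$.
   Context: A set of reals is a subset of $\mathbb{R}\setminus\mathbb{Q}$ (equivalently, up to homeomorphism, a separable zero-dimensional metric space). For a set of reals $X$: a countable open cover $\mathcal{U}$ of $X$ is an $\omega$-cover if $X\notin\mathcal{U}$ and every finite $F\subseteq X$ is contained in some $U\in\mathcal{U}$; it is a $\gamma$-cover if it is infinite and for each $x\in X$ the set $\{U\in\mathcal{U}: x\notin U\}$ is finite. $\Omega$ and $\Gamma$ denote the collections of countable open $\omega$-covers and $\gamma$-covers of $X$. $X$ satisfies $\mathsf{S}_1(\Omega,\Omega)$ if for every sequence $\langle \mathcal{U}_n:n\in\omega\rangle$ of $\omega$-covers of $X$ there are $U_n\in\mathcal{U}_n$ such that $\{U_n:n\in\omega\}$ is an $\omega$-cover of $X$. $X$ satisfies $\mathsf{U}_{fin}(\Gamma,\Omega)$ if for every sequence $\langle \mathcal{U}_n:n\in\omega\rangle$ of $\gamma$-covers of $X$, none of which contains a finite subcover, there are finite $\mathcal{V}_n\subseteq\mathcal{U}_n$ such that $\{\bigcup\mathcal{V}_n:n\in\omega\}$ is an $\omega$-cover of $X$. *)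

theory Defs
  imports "HOL-Analysis.Analysis" "HOL-Library.Equipollence"
begin

definition nowhere_dense :: "'a::topological_space set \<Rightarrow> bool" where
  "nowhere_dense A \<longleftrightarrow> interior (closure A) = {}"

definition meager :: "'a::topological_space set \<Rightarrow> bool" where
  "meager A \<longleftrightarrow> (\<exists>N :: nat \<Rightarrow> 'a set. (\<forall>n. nowhere_dense (N n)) \<and> A = (\<Union>n. N n))"

text \<open>
  The type \<^typ>\<open>nat \<Rightarrow> bool\<close>, with the product topology of the library and the discrete
  topology on \<^typ>\<open>bool\<close>, is the Cantor space; it also serves as a set of cardinality
  continuum.
\<close>

definition cantor_not_small_union_of_meager :: bool where
  "cantor_not_small_union_of_meager \<longleftrightarrow>
    \<not> (\<exists>\<M> :: (nat \<Rightarrow> bool) set set.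
         \<M> \<prec> (UNIV :: (nat \<Rightarrow> bool) set) \<and> (\<forall>M\<in>\<M>. meager M) \<and> \<Union>\<M> = UNIV)"

definition set_of_reals :: "real set \<Rightarrow> bool" where
  "set_of_reals X \<longleftrightarrow> X \<subseteq> - \<rat>"

text \<open>
  Covers of \<open>X\<close> consist of relatively open subsets of \<open>X\<close>; this is what gives the
  condition that \<open>X\<close> is not a member of an \<open>\<omega>\<close>-cover its intended meaning.
\<close>

definition countable_open_cover :: "'a::topological_space set \<Rightarrow> 'a set set \<Rightarrow> bool" where
  "countable_open_cover X \<U> \<longleftrightarrow>
     countable \<U> \<and> (\<forall>U\<in>\<U>. openin (top_of_set X) U) \<and> \<Union>\<U> = X"

definition omega_covers :: "'a::topological_space set \<Rightarrow> 'a set set set" where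
  "omega_covers X = {\<U>. countable_open_cover X \<U> \<and> X \<notin> \<U> \<and>
     (\<forall>F. finite F \<and> F \<subseteq> X \<longrightarrow> (\<exists>U\<in>\<U>. F \<subseteq> U))}"

definition gamma_covers :: "'a::topological_space set \<Rightarrow> 'a set set set" where
  "gamma_covers X = {\<U>. countable_open_cover X \<U> \<and> infinite \<U> \<and>
     (\<forall>x\<in>X. finite {U \<in> \<U>. x \<notin> U})}"

definition S1 :: "'a set set set \<Rightarrow> 'a set set set \<Rightarrow> bool" where
  "S1 \<A> \<B> \<longleftrightarrow>
     (\<forall>\<U> :: nat \<Rightarrow> 'a set set. (\<forall>n. \<U> n \<in> \<A>) \<longrightarrow>
        (\<exists>U :: nat \<Rightarrow> 'a set. (\<forall>n. U n \<in> \<U> n) \<and> {U n | n. True} \<in> \<B>))"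

definition Ufin :: "'a set \<Rightarrow> 'a set set set \<Rightarrow> 'a set set set \<Rightarrow> bool" where
  "Ufin X \<A> \<B> \<longleftrightarrow>
     (\<forall>\<U> :: nat \<Rightarrow> 'a set set.
        (\<forall>n. \<U> n \<in> \<A> \<and> \<not> (\<exists>\<V>. finite \<V> \<and> \<V> \<subseteq> \<U> n \<and> \<Union>\<V> = X)) \<longrightarrow>
        (\<exists>\<V> :: nat \<Rightarrow> 'a set set. (\<forall>n. finite (\<V> n) \<and> \<V> n \<subseteq> \<U> n) \<and>
           {\<Union>(\<V> n) | n. True} \<in> \<B>))"

end

theory Submission
  imports Defs
begin

text \<open>
  Work in the Baire space, identify it with a set of irrationals at the end, and let \<open>D\<close> be a
  countable dense set. By transfinite recursion of length continuum build
  \<open>X\<^sub>i = D \<union> {x\<^sub>i(\<alpha>)}\<close>, \<open>i = 1, 2\<close>. At stage \<open>\<alpha>\<close> the set constructed so far has fewer than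
  continuum many points, so from the \<open>\<alpha>\<close>-th sequence of \<open>\<omega>\<close>-covers one can select an
  \<open>\<omega>\<close>-cover of it: the selectors that work for one finite set form a dense open set. The selected
  family remains an \<open>\<omega>\<close>-cover if each later point lies, for every finite \<open>F\<close> among the earlier
  points, in the union of those selected sets that contain \<open>F\<close>; this union is open and contains
  \<open>D\<close>, so it is dense. Hence fewer than continuum many dense open conditions have to be met by
  \<open>x\<^sub>1(\<alpha>)\<close> and by \<open>x\<^sub>2(\<alpha>)\<close>, where \<open>x\<^sub>2(\<alpha>)\<close> is the image of \<open>x\<^sub>1(\<alpha>)\<close> under a coordinatewise
  involution chosen so that \<open>max(x\<^sub>1(\<alpha>), x\<^sub>2(\<alpha>))\<close> dominates the \<open>\<alpha>\<close>-th element of the Baire space.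
  Pairs from \<open>X\<^sub>1 \<union> X\<^sub>2\<close> are then dominating, and the \<open>\<gamma>\<close>-covers \<open>{f. f n \<le> m}\<close>, \<open>m \<in> \<omega>\<close>,
  witness the failure of \<open>U\<^sub>f\<^sub>i\<^sub>n(\<Gamma>, \<Omega>)\<close>.
\<close>

section \<open>Cardinals\<close>

lemma lesspoll_iff_ordLess: "A \<prec> B \<longleftrightarrow> (card_of A, card_of B) \<in> ordLess"
  by (metis card_of_ordLess lepoll_antisym lepoll_def lesspoll_def eqpoll_imp_lepoll eqpoll_sym card_of_ordLeq ordLess_imp_ordLeq)

text \<open>The finite subsets are graded by size: \<open>S (Suc n)\<close> is contained in an image
  of \<open>A \<times> S n\<close>, so induction bounds every level by \<open>A\<close>, and a
  countable union of levels stays within the infinite \<open>A\<close>.\<close>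

lemma Fpow_lepoll_infinite:
  assumes "infinite A"
  shows "Fpow A \<lesssim> A"
proof -
  define S where "S n = {F. F \<subseteq> A \<and> finite F \<and> card F = n}" for n
  have S: "S n \<lesssim> A" for n
  proof (induction n)
    case 0
    have "S 0 \<subseteq> {{}}" by (auto simp: S_def)
    then have "finite (S 0)" by (rule finite_subset) simp
    with assms show ?case by (simp add: finite_lepoll_infinite)
  next
    case (Suc n)
    have "S (Suc n) \<subseteq> (\<lambda>(x, F). insert x F) ` (A \<times> S n)"
    proof
      fix F assume F: "F \<in> S (Suc n)"
      then obtain x B where "F = insert x B" "x \<notin> B" "card B = n"
        by (auto simp: S_def card_Suc_eq)
      with F show "F \<in> (\<lambda>(x, F). insert x F) ` (A \<times> S n)"
        by (force simp: S_def)
    qed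
    then have "S (Suc n) \<lesssim> A \<times> S n"
      by (metis image_lepoll lepoll_trans subset_imp_lepoll)
    also have "\<dots> \<lesssim> A \<times> A" using Suc.IH by (intro times_lepoll_mono lepoll_refl)
    also have "\<dots> \<lesssim> A" by (simp add: assms eqpoll_iff_card_of_ordIso card_of_Times_same_infinite eqpoll_imp_lepoll)
    finally show ?case .
  qed
  have "(card_of (\<Union>n\<in>(UNIV::nat set). S n), card_of A) \<in> ordLeq"
    using assms S infinite_iff_card_of_nat[of A]
    by (intro card_of_UNION_ordLeq_infinite) (auto simp: lepoll_def card_of_ordLeq)
  moreover have "Fpow A = (\<Union>n. S n)" by (auto simp: S_def Fpow_def)
  ultimately show ?thesis by (simp add: lepoll_def card_of_ordLeq)
qed

lemma Fpow_lesspoll_infinite: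
  assumes "A \<prec> C" "infinite C"
  shows "Fpow A \<prec> C"
proof (cases "finite A")
  case True
  then have "finite (Fpow A)" by (simp add: Fpow_Pow_finite)
  then show ?thesis using assms(2) by (rule finite_lesspoll_infinite[rotated])
next
  case False
  then show ?thesis by (rule lesspoll_trans1[OF Fpow_lepoll_infinite assms(1)])
qed

lemma Un_lesspoll_infinite:
  assumes "A \<prec> C" "B \<prec> C" "infinite C"
  shows "A \<union> B \<prec> C"
  using assms card_of_Un_ordLess_infinite by (simp add: lesspoll_iff_ordLess)

lemma Times_lesspoll_infinite:
  assumes "A \<prec> C" "B \<prec> C" "infinite C"
  shows "A \<times> B \<prec> C"
proof -
  have total: "A \<lesssim> B \<or> B \<lesssim> A"
    using ordLeq_total[OF card_of_Well_order card_of_Well_order, of A B]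
    by (simp add: lepoll_def card_of_ordLeq)
  show ?thesis
  proof (cases "finite (A \<times> B)")
    case True
    then show ?thesis using assms(3) by (rule finite_lesspoll_infinite[rotated])
  next
    case False
    have "A \<times> B \<lesssim> A \<or> A \<times> B \<lesssim> B"
      using total
    proof
      assume le: "A \<lesssim> B"
      then have "finite B \<Longrightarrow> finite A" unfolding lepoll_def by (metis inj_on_finite)
      with False have "infinite B" by blast
      then show ?thesis using times_lepoll_mono[OF le lepoll_refl] card_of_Times_same_infinite
        by (metis eqpoll_iff_card_of_ordIso eqpoll_imp_lepoll lepoll_trans)
    next
      assume le: "B \<lesssim> A"
      then have "finite A \<Longrightarrow> finite B" unfolding lepoll_def by (metis inj_on_finite)
      with False have "infinite A" by blast
      then show ?thesis using times_lepoll_mono[OF lepoll_refl le] card_of_Times_same_infinite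
        by (metis eqpoll_iff_card_of_ordIso eqpoll_imp_lepoll lepoll_trans)
    qed
    then show ?thesis using lesspoll_trans1[OF _ assms(1)] lesspoll_trans1[OF _ assms(2)] by metis
  qed
qed

lemma countable_lesspoll_uncountable:
  assumes "countable A" "uncountable B"
  shows "A \<prec> B"
proof -
  have "A \<lesssim> (UNIV :: nat set)" using assms(1) unfolding countable_def lepoll_def by blast
  also have "\<dots> \<lesssim> B" using uncountable_infinite[OF assms(2)] by (simp add: infinite_le_lepoll)
  finally have "A \<lesssim> B" .
  moreover have "\<not> B \<lesssim> A" using assms countable_lepoll by metis
  ultimately show ?thesis unfolding lesspoll_def using eqpoll_imp_lepoll eqpoll_sym by metis
qed

text \<open>The strict part of the cardinal well-order of the type: its order type is an initial
  ordinal, so proper initial segments are smaller than the whole. This keeps each stage of the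
  recursion below the continuum.\<close>

lemma small_wellorder:
  "\<exists>R :: 'a rel. wf R \<and> trans R \<and> total R \<and> (\<forall>a. {b. (b, a) \<in> R} \<prec> (UNIV :: 'a set))"
proof -
  let ?r = "card_of (UNIV :: 'a set)"
  have F: "Field ?r = UNIV" by (simp add: Field_card_of)
  with card_of_Well_order[of "UNIV :: 'a set"] have wo: "well_order ?r" by simp
  let ?R = "?r - Id"
  have "{b. (b, a) \<in> ?R} \<prec> (UNIV :: 'a set)" for a
    using card_of_underS[OF card_of_Card_order, of a UNIV] F
    by (auto simp: lesspoll_iff_ordLess underS_def conj_commute)
  moreover have "wf ?R" "trans ?R" "total ?R"
    using wo F by (auto simp: well_order_on_def linear_order_on_def partial_order_on_def preorder_on_def
      total_on_def intro!: trans_diff_Id)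
  ultimately show ?thesis by blast
qed


section \<open>Open dense sets in the Cantor and Baire spaces\<close>

lemma open_iff_cylinders:
  fixes G :: "(nat \<Rightarrow> 'a::discrete_topology) set"
  shows "open G \<longleftrightarrow> (\<forall>x\<in>G. \<exists>N. \<forall>y. (\<forall>i<N. y i = x i) \<longrightarrow> y \<in> G)"
proof
  assume G: "open G"
  show "\<forall>x\<in>G. \<exists>N. \<forall>y. (\<forall>i<N. y i = x i) \<longrightarrow> y \<in> G"
  proof
    fix x assume "x \<in> G"
    then obtain X where X: "x \<in> (\<Pi>\<^sub>E i\<in>UNIV. X i)" "finite {i. X i \<noteq> UNIV}" "(\<Pi>\<^sub>E i\<in>UNIV. X i) \<subseteq> G"
      using product_topology_open_contains_basis[of "\<lambda>_. euclidean" UNIV G x] G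
      by (auto simp: open_fun_def)
    obtain N where N: "\<And>i. X i \<noteq> UNIV \<Longrightarrow> i < N"
      using X(2) finite_nat_set_iff_bounded by auto
    have "y \<in> G" if "\<forall>i<N. y i = x i" for y
    proof -
      have "y i \<in> X i" for i
        using N[of i] X(1) that by (cases "X i = UNIV") (auto simp: PiE_iff)
      then show ?thesis using X(3) by auto
    qed
    then show "\<exists>N. \<forall>y. (\<forall>i<N. y i = x i) \<longrightarrow> y \<in> G" by blast
  qed
next
  assume *: "\<forall>x\<in>G. \<exists>N. \<forall>y. (\<forall>i<N. y i = x i) \<longrightarrow> y \<in> G"
  show "open G"
  proof (subst open_subopen, intro ballI)
    fix x assume "x \<in> G"
    then obtain N where N: "\<And>y. (\<forall>i<N. y i = x i) \<Longrightarrow> y \<in> G" using * by blast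
    have "open {y. \<forall>i\<in>{..<N}. y i \<in> {x i}}"
      by (rule product_topology_basis') (auto simp: open_discrete)
    then show "\<exists>T. open T \<and> x \<in> T \<and> T \<subseteq> G"
      using N by (intro exI[of _ "{y. \<forall>i\<in>{..<N}. y i \<in> {x i}}"]) auto
  qed
qed

lemma closure_eq_UNIV_iff_cylinders:
  fixes G :: "(nat \<Rightarrow> 'a::discrete_topology) set"
  shows "closure G = UNIV \<longleftrightarrow> (\<forall>x N. \<exists>y\<in>G. \<forall>i<N. y i = x i)"
proof
  assume cl: "closure G = UNIV"
  show "\<forall>x N. \<exists>y\<in>G. \<forall>i<N. y i = x i"
  proof (intro allI)
    fix x :: "nat \<Rightarrow> 'a" and N :: nat
    have "open {y. \<forall>i\<in>{..<N}. y i \<in> {x i}}"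
      by (rule product_topology_basis') (auto simp: open_discrete)
    then have "G \<inter> {y. \<forall>i\<in>{..<N}. y i \<in> {x i}} \<noteq> {}"
      using cl open_Int_closure_eq_empty[of "{y. \<forall>i\<in>{..<N}. y i \<in> {x i}}" G] by auto
    then show "\<exists>y\<in>G. \<forall>i<N. y i = x i" by auto
  qed
next
  assume *: "\<forall>x N. \<exists>y\<in>G. \<forall>i<N. y i = x i"
  have "x \<in> closure G" for x
    unfolding closure_iff_nhds_not_empty
  proof (intro allI impI)
    fix A V assume V: "V \<subseteq> A" "open V" "x \<in> V"
    then obtain N where "\<And>y. (\<forall>i<N. y i = x i) \<Longrightarrow> y \<in> V"
      unfolding open_iff_cylinders by metis
    moreover obtain y where "y \<in> G" "\<forall>i<N. y i = x i" using * by metis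
    ultimately show "G \<inter> A \<noteq> {}" using V(1) by blast
  qed
  then show "closure G = UNIV" by blast
qed

text \<open>
  Points of the Cantor space are read as 0-1 matrices; a row without a 1 gets a junk value. The
  map transfers the covering assumption to the Baire space although it is not continuous.
\<close>

definition first_true :: "(nat \<Rightarrow> bool) \<Rightarrow> nat \<Rightarrow> nat" where
  "first_true x n = (LEAST k. x (prod_encode (n, k)))"

lemma first_true_eqI:
  assumes "x (prod_encode (n, m))" "\<And>k. k < m \<Longrightarrow> \<not> x (prod_encode (n, k))"
  shows "first_true x n = m"
  unfolding first_true_def using assms by (intro Least_equality) (auto simp: not_less[symmetric])

lemma surj_first_true: "surj first_true"
proof
  show "UNIV \<subseteq> range first_true"
  proof
    fix f :: "nat \<Rightarrow> nat"
    have "first_true (\<lambda>i. case prod_decode i of (n, k) \<Rightarrow> k = f n) = f"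
      by (rule ext, rule first_true_eqI) auto
    then show "f \<in> range first_true" by (metis rangeI)
  qed
qed simp

text \<open>The preimage of \<open>G\<close> need not be open, because of rows without a 1.
  \<open>W\<close> therefore collects the points some initial segment of which already forces the
  value into \<open>G\<close>.\<close>

lemma first_true_preimage_dense:
  assumes "open G" "closure G = UNIV"
  shows "\<exists>W. open W \<and> closure W = UNIV \<and> first_true ` W \<subseteq> G"
proof (intro exI conjI)
  let ?W = "{x. \<exists>N. \<forall>x'. (\<forall>i<N. x' i = x i) \<longrightarrow> first_true x' \<in> G}"
  show "open ?W"
    unfolding open_iff_cylinders
  proof
    fix x assume "x \<in> ?W"
    then obtain N where N: "\<And>x'. (\<forall>i<N. x' i = x i) \<Longrightarrow> first_true x' \<in> G" by blast
    have "y \<in> ?W" if "\<forall>i<N. y i = x i" for y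
      using N that by (auto intro!: exI[of _ N])
    then show "\<exists>N. \<forall>y. (\<forall>i<N. y i = x i) \<longrightarrow> y \<in> ?W" by blast
  qed
  show "closure ?W = UNIV"
    unfolding closure_eq_UNIV_iff_cylinders
  proof (intro allI)
    fix x\<^sub>0 :: "nat \<Rightarrow> bool" and N\<^sub>0 :: nat
    \<comment> \<open>Padding with 1s puts a 1 into every row, so no value of
      \<open>first_true x\<^sub>1\<close> is junk.\<close>
    define x\<^sub>1 where "x\<^sub>1 i = (if i < N\<^sub>0 then x\<^sub>0 i else True)" for i
    obtain g where g: "g \<in> G" "\<And>n. n < N\<^sub>0 \<Longrightarrow> g n = first_true x\<^sub>1 n"
      using assms(2) unfolding closure_eq_UNIV_iff_cylinders by blast
    obtain M where M: "\<And>g'. (\<forall>n<M. g' n = g n) \<Longrightarrow> g' \<in> G"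
      using assms(1) g(1) unfolding open_iff_cylinders by blast
    \<comment> \<open>Rows from \<open>N\<^sub>0\<close> on get their only 1 in column
      \<open>g n\<close>. Since a code is at least its row number, they do not touch the first
      \<open>N\<^sub>0\<close> entries.\<close>
    define x where "x i = (case prod_decode i of (n, k) \<Rightarrow> if n < N\<^sub>0 then x\<^sub>1 i else k = g n)" for i
    have x_pair: "x (prod_encode (n, k)) = (if n < N\<^sub>0 then x\<^sub>1 (prod_encode (n, k)) else k = g n)" for n k
      by (simp add: x_def)
    have x1: "x\<^sub>1 (prod_encode (n, first_true x\<^sub>1 n))" for n
      unfolding first_true_def
      by (rule LeastI[of _ N\<^sub>0]) (use le_prod_encode_2[of N\<^sub>0 n] in \<open>simp add: x\<^sub>1_def\<close>)
    have hit: "x (prod_encode (n, g n))" for n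
      using x1[of n] g(2)[of n] by (simp add: x_pair)
    have miss: "\<not> x (prod_encode (n, k))" if "k < g n" for n k
      using that g(2)[of n] not_less_Least[of k "\<lambda>k. x\<^sub>1 (prod_encode (n, k))"]
      by (auto simp: x_pair first_true_def)
    have agree: "x i = x\<^sub>0 i" if "i < N\<^sub>0" for i
    proof -
      obtain n k where i: "i = prod_encode (n, k)" by (metis prod_decode_inverse surj_pair)
      with that have "n < N\<^sub>0" using le_prod_encode_1[of n k] by simp
      with i that show ?thesis by (simp add: x_pair x\<^sub>1_def)
    qed
    \<comment> \<open>These finitely many cells, up to the first 1 in each of the rows below
      \<open>M\<close>, determine the first \<open>M\<close> values.\<close>
    have "finite (\<Union>n<M. (\<lambda>k. prod_encode (n, k)) ` {..g n})" by simp
    then obtain N where "\<And>i. i \<in> (\<Union>n<M. (\<lambda>k. prod_encode (n, k)) ` {..g n}) \<Longrightarrow> i < N"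
      unfolding finite_nat_set_iff_bounded by blast
    then have N: "prod_encode (n, k) < N" if "n < M" "k \<le> g n" for n k
      using that by blast
    have "first_true x' \<in> G" if x': "\<forall>i<N. x' i = x i" for x'
    proof (rule M, intro allI impI)
      fix n assume "n < M"
      with N x' have "x' (prod_encode (n, k)) = x (prod_encode (n, k))" if "k \<le> g n" for k
        using that by blast
      then show "first_true x' n = g n" using hit miss by (intro first_true_eqI) auto
    qed
    then show "\<exists>y\<in>?W. \<forall>i<N\<^sub>0. y i = x\<^sub>0 i" using agree by blast
  qed
  show "first_true ` ?W \<subseteq> G" by blast
qed

lemma nowhere_dense_compl_open_dense:
  assumes "open W" "closure W = UNIV"
  shows "nowhere_dense (- W)"
  using assms by (simp add: nowhere_dense_def interior_complement closure_complement interior_open)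

text \<open>Each \<open>G i\<close> is pulled back to a dense open \<open>W i\<close> in the Cantor
  space. Fewer than continuum many nowhere dense complements leave a point uncovered, and its image
  under \<open>first_true\<close> lies in every \<open>G i\<close>.\<close>

lemma baire_small_intersection:
  fixes G :: "'i \<Rightarrow> (nat \<Rightarrow> nat) set"
  assumes cov: cantor_not_small_union_of_meager
    and small: "I \<prec> (UNIV :: (nat \<Rightarrow> bool) set)"
    and G: "\<And>i. i \<in> I \<Longrightarrow> open (G i)" "\<And>i. i \<in> I \<Longrightarrow> closure (G i) = UNIV"
  shows "\<exists>x. \<forall>i\<in>I. x \<in> G i"
proof -
  obtain W where W: "\<And>i. i \<in> I \<Longrightarrow> open (W i) \<and> closure (W i) = UNIV \<and> first_true ` W i \<subseteq> G i"
    using first_true_preimage_dense[OF G] by metis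
  have "meager (- W i)" if "i \<in> I" for i
    unfolding meager_def using W[OF that]
    by (intro exI[of _ "\<lambda>_. - W i"]) (simp add: nowhere_dense_compl_open_dense)
  moreover have "(\<lambda>i. - W i) ` I \<prec> (UNIV :: (nat \<Rightarrow> bool) set)"
    by (rule lesspoll_trans1[OF image_lepoll small])
  ultimately have "(\<Union>i\<in>I. - W i) \<noteq> UNIV"
    using cov unfolding cantor_not_small_union_of_meager_def by blast
  then obtain x where "x \<in> W i" if "i \<in> I" for i by blast
  with W show ?thesis by blast
qed

section \<open>Embedding the Baire space into the irrationals\<close>

text \<open>Up to the factor 2/3, the points of the middle-thirds Cantor set. A ratio below 1/2
  makes the digits recoverable.\<close>

definition ternary :: "(nat \<Rightarrow> bool) \<Rightarrow> real" where
  "ternary c = (\<Sum>n. of_bool (c n) * (1/3) ^ n)"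

lemma summable_ternary: "summable (\<lambda>n. of_bool (c n) * (1/3) ^ n :: real)"
  by (rule summable_comparison_test'[OF summable_geometric[of "1/3::real"], of 0]) auto

text \<open>At the first differing digit \<open>m \<le> n\<close> the sums differ by
  \<open>(1/3) ^ m\<close>, and the tail can cancel at most half of that.\<close>

lemma ternary_digit_eq:
  assumes "dist (ternary c) (ternary d) < (1/3) ^ n / 2"
  shows "c n = d n"
proof (rule ccontr)
  assume "c n \<noteq> d n"
  define m where "m = (LEAST k. c k \<noteq> d k)"
  have cm: "c m \<noteq> d m" and mn: "m \<le> n"
    unfolding m_def using \<open>c n \<noteq> d n\<close> by (rule LeastI, rule Least_le)
  have eq: "c k = d k" if "k < m" for k
    using not_less_Least[of k "\<lambda>k. c k \<noteq> d k"] that by (auto simp: m_def)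
  define e :: "nat \<Rightarrow> real" where "e k = (of_bool (c k) - of_bool (d k)) * (1/3) ^ k" for k :: nat
  have se: "summable e"
    unfolding e_def using summable_diff[OF summable_ternary[of c] summable_ternary[of d]]
    by (simp add: algebra_simps)
  have "ternary c - ternary d = (\<Sum>k. e k)"
    unfolding ternary_def e_def using suminf_diff[OF summable_ternary[of c] summable_ternary[of d]]
    by (simp add: algebra_simps)
  also have "\<dots> = (\<Sum>k. e (k + Suc m)) + (\<Sum>k<Suc m. e k)"
    by (rule suminf_split_initial_segment[OF se])
  also have "(\<Sum>k<Suc m. e k) = e m"
    by (simp add: e_def eq)
  finally have diff: "ternary c - ternary d = (\<Sum>k. e (k + Suc m)) + e m" .
  have em: "\<bar>e m\<bar> = (1/3) ^ m"
    using cm by (auto simp: e_def)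
  have geo: "(\<lambda>k. (1/3 :: real) ^ (k + Suc m)) sums ((1/3) ^ m / 2)"
  proof -
    have "(\<lambda>k. (1/3 :: real) ^ Suc m * (1/3) ^ k) sums ((1/3) ^ Suc m * (1 / (1 - 1/3)))"
      by (intro sums_mult geometric_sums) simp
    then show ?thesis by (simp add: power_add mult_ac)
  qed
  have "\<bar>\<Sum>k. e (k + Suc m)\<bar> \<le> (1/3) ^ m / 2"
    using norm_suminf_le[of "\<lambda>k. e (k + Suc m)" "\<lambda>k. (1/3) ^ (k + Suc m)"]
      sums_summable[OF geo] sums_unique[OF geo] by (auto simp: e_def abs_mult)
  then have "dist (ternary c) (ternary d) \<ge> (1/3) ^ m / 2"
    unfolding dist_real_def using diff em by linarith
  moreover have "(1/3 :: real) ^ n \<le> (1/3) ^ m"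
    using mn by (intro power_decreasing) auto
  ultimately show False using assms by simp
qed

lemma continuous_on_ternary:
  assumes "\<And>n. continuous_on S (\<lambda>x. of_bool (c x n) :: real)"
  shows "continuous_on S (\<lambda>x. ternary (c x))"
proof (rule uniform_limit_theorem)
  show "uniform_limit S (\<lambda>N x. \<Sum>n<N. of_bool (c x n) * (1/3) ^ n) (\<lambda>x. ternary (c x)) sequentially"
    unfolding ternary_def
    by (rule Weierstrass_m_test[where M = "\<lambda>n. (1/3) ^ n"]) (auto simp: summable_geometric)
  show "\<forall>\<^sub>F N in sequentially. continuous_on S (\<lambda>x. \<Sum>n<N. of_bool (c x n) * (1/3 :: real) ^ n)"
    by (intro always_eventually allI continuous_intros assms)
qed simp

lemma uncountable_cantor: "uncountable (UNIV :: (nat \<Rightarrow> bool) set)"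
proof
  assume "countable (UNIV :: (nat \<Rightarrow> bool) set)"
  then obtain f :: "nat \<Rightarrow> nat \<Rightarrow> bool" where f: "range f = UNIV"
    using uncountable_def by blast
  then obtain n where "f n = (\<lambda>k. \<not> f k k)" by (metis rangeE UNIV_I)
  then show False by metis
qed

text \<open>The even digits encode the graph of \<open>f\<close>: digit
  \<open>2 * prod_encode (n, k)\<close> records whether \<open>f n = k\<close>. The odd digits are a
  parameter used to avoid the rationals. The last conjunct yields injectivity and continuity of the
  inverse.\<close>

lemma baire_space_embedding_irrationals:
  "\<exists>E :: (nat \<Rightarrow> nat) \<Rightarrow> real. continuous_on UNIV E \<and> range E \<inter> \<rat> = {} \<and>
     (\<forall>n k. \<exists>e>0. \<forall>f g. f n = k \<longrightarrow> dist (E g) (E f) < e \<longrightarrow> g n = k)"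
proof -
  define code where "code h f k = (if even k
     then f (fst (prod_decode (k div 2))) = snd (prod_decode (k div 2)) else h (k div 2))"
    for h :: "nat \<Rightarrow> bool" and f :: "nat \<Rightarrow> nat" and k :: nat
  have inj: "c = d" if "ternary c = ternary d" for c d
    using that by (intro ext ternary_digit_eq) simp
  have code_h: "code h f (2 * k + 1) = h k" for h f k by (simp add: code_def)
  \<comment> \<open>The odd digits make the ranges for different \<open>h\<close> disjoint, so only countably many \<open>h\<close> meet \<open>\<rat>\<close>.\<close>
  have "\<exists>h. \<forall>f. ternary (code h f) \<notin> \<rat>"
  proof (rule ccontr)
    assume "\<nexists>h. \<forall>f. ternary (code h f) \<notin> \<rat>"
    then obtain F where F: "\<And>h. ternary (code h (F h)) \<in> \<rat>" by metis
    have "inj (\<lambda>h. ternary (code h (F h)))"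
    proof (rule injI)
      fix h h' assume "ternary (code h (F h)) = ternary (code h' (F h'))"
      then have "code h (F h) = code h' (F h')" by (rule inj)
      then show "h = h'" by (intro ext) (metis code_h)
    qed
    moreover have "countable (range (\<lambda>h. ternary (code h (F h))))"
      using F by (intro countable_subset[OF _ countable_rat]) auto
    ultimately show False using uncountable_cantor countable_image_inj_on by blast
  qed
  then obtain h where h: "\<And>f. ternary (code h f) \<notin> \<rat>" by blast
  let ?E = "\<lambda>f. ternary (code h f)"
  have "continuous_on UNIV ?E"
  proof (rule continuous_on_ternary)
    fix n
    define i j where "i = fst (prod_decode (n div 2))" and "j = snd (prod_decode (n div 2))"
    have "continuous_on UNIV (\<lambda>f::nat \<Rightarrow> nat. of_bool (f i = j) :: real)"
      by (rule continuous_on_compose2[of UNIV "\<lambda>m. of_bool (m = j)" UNIV "\<lambda>f. f i"]) auto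
    then show "continuous_on UNIV (\<lambda>f. of_bool (code h f n) :: real)"
      by (cases "even n") (auto simp: code_def i_def j_def)
  qed
  moreover have "\<exists>e>0. \<forall>f g. f n = k \<longrightarrow> dist (?E g) (?E f) < e \<longrightarrow> g n = k" for n k
  proof (intro exI[of _ "(1/3) ^ (2 * prod_encode (n, k)) / 2"] conjI allI impI)
    fix f g :: "nat \<Rightarrow> nat"
    assume "f n = k" "dist (?E g) (?E f) < (1/3) ^ (2 * prod_encode (n, k)) / 2"
    then show "g n = k"
      using ternary_digit_eq[of "code h g" "code h f"] by (fastforce simp: code_def)
  qed simp
  ultimately show ?thesis using h by (intro exI[of _ ?E]) blast
qed

section \<open>The transfinite construction\<close>

text \<open>The involution exchanging the blocks [0, m) and [m, 2m): of \<open>k\<close> and its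
  image, at least one is not below \<open>m\<close>.\<close>

definition reflect :: "nat \<Rightarrow> nat \<Rightarrow> nat" where
  "reflect m k = (if k < m then k + m else if k < 2 * m then k - m else k)"

lemma reflect_reflect [simp]: "reflect m (reflect m k) = k"
  by (auto simp: reflect_def)

lemma le_max_reflect: "m \<le> max k (reflect m k)"
  by (auto simp: reflect_def)

lemma continuous_on_coordinatewise_discrete:
  fixes t :: "nat \<Rightarrow> 'a::discrete_topology \<Rightarrow> 'b::topological_space"
  shows "continuous_on UNIV (\<lambda>x n. t n (x n))"
proof (rule continuous_on_coordinatewise_then_product)
  show "continuous_on UNIV (\<lambda>x. t n (x n))" for n
    by (rule continuous_on_compose2[of UNIV "t n" UNIV "\<lambda>x. x n"]) auto
qed

lemma dense_reflect_vimage: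
  fixes G :: "(nat \<Rightarrow> nat) set"
  assumes "closure G = UNIV"
  shows "closure ((\<lambda>x n. reflect (y n) (x n)) -` G) = UNIV"
  unfolding closure_eq_UNIV_iff_cylinders
proof (intro allI)
  fix x :: "nat \<Rightarrow> nat" and N
  obtain z where z: "z \<in> G" "\<forall>i<N. z i = reflect (y i) (x i)"
    using assms[unfolded closure_eq_UNIV_iff_cylinders, rule_format, of N "\<lambda>i. reflect (y i) (x i)"] by blast
  then show "\<exists>w\<in>(\<lambda>x n. reflect (y n) (x n)) -` G. \<forall>i<N. w i = x i"
    by (intro bexI[of _ "\<lambda>n. reflect (y n) (z n)"]) auto
qed

text \<open>A double sequence is coded by the set of triples \<open>(n, m, k)\<close> for which the
  \<open>k\<close>-th basic open set lies inside \<open>V n m\<close>. So recursion stages indexed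
  by the Cantor space can treat all of them.\<close>

lemma open_double_sequences_enumeration:
  "\<exists>U :: (nat \<Rightarrow> bool) \<Rightarrow> nat \<Rightarrow> nat \<Rightarrow> 'a::second_countable_topology set.
     (\<forall>a n m. open (U a n m)) \<and> (\<forall>V. (\<forall>n m. open (V n m)) \<longrightarrow> (\<exists>a. U a = V))"
proof -
  obtain B :: "'a set set" where B: "countable B" "topological_basis B"
    using ex_countable_basis by blast
  have ne: "B \<noteq> {}"
    using B(2) by (metis UNIV_I open_UNIV topological_basisE empty_iff)
  define b where "b = from_nat_into B"
  have b: "range b = B" using B(1) ne by (simp add: b_def range_from_nat_into)
  define U where "U a n m = \<Union>{b k | k. a (prod_encode (n, prod_encode (m, k)))}"
    for a :: "nat \<Rightarrow> bool" and n m
  have "open (b k)" for k using B(2) b topological_basis_open by blast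
  then have "open (U a n m)" for a n m by (auto simp: U_def)
  moreover have "\<exists>a. U a = V" if V: "\<And>n m. open (V n m)" for V
  proof -
    define a where "a i = (case prod_decode i of (n, j) \<Rightarrow> case prod_decode j of (m, k) \<Rightarrow> b k \<subseteq> V n m)" for i
    have "U a n m = V n m" for n m
    proof
      show "V n m \<subseteq> U a n m"
      proof
        fix x assume "x \<in> V n m"
        then obtain C where "C \<in> B" "x \<in> C" "C \<subseteq> V n m"
          using topological_basisE[OF B(2) V] by metis
        then show "x \<in> U a n m" using b by (auto simp: U_def a_def)
      qed
    qed (auto simp: U_def a_def)
    then show ?thesis by blast
  qed
  ultimately show ?thesis by blast
qed

lemma finite_has_greatest:
  assumes "finite J" "J \<noteq> {}" "trans R" "total R"
  shows "\<exists>m\<in>J. \<forall>b\<in>J. b = m \<or> (b, m) \<in> R"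
  using assms(1,2)
proof (induction J rule: finite_ne_induct)
  case (insert x J)
  then obtain m where m: "m \<in> J" "\<forall>b\<in>J. b = m \<or> (b, m) \<in> R" by blast
  consider "x = m" | "(x, m) \<in> R" | "(m, x) \<in> R" using assms(4) unfolding total_on_def by blast
  then show ?case
    using m assms(3) by cases (blast, blast, metis insert_iff transD)
qed simp

text \<open>For a fixed \<open>F\<close>, success of \<open>h\<close> is witnessed by one
  coordinate, which gives openness; that coordinate may lie beyond any prescribed initial segment,
  which gives density.\<close>

lemma small_selection:
  assumes cov: cantor_not_small_union_of_meager
    and small: "X \<prec> (UNIV :: (nat \<Rightarrow> bool) set)"
    and U: "\<And>n F. finite F \<Longrightarrow> F \<subseteq> X \<Longrightarrow> \<exists>m. F \<subseteq> U n m"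
  shows "\<exists>h :: nat \<Rightarrow> nat. \<forall>F. finite F \<and> F \<subseteq> X \<longrightarrow> (\<exists>n. F \<subseteq> U n (h n))"
proof -
  have inf: "infinite (UNIV :: (nat \<Rightarrow> bool) set)"
    using uncountable_cantor by (rule uncountable_infinite)
  have "\<exists>h. \<forall>F\<in>Fpow X. h \<in> {h. \<exists>n. F \<subseteq> U n (h n)}"
  proof (rule baire_small_intersection[OF cov Fpow_lesspoll_infinite[OF small inf]])
    fix F assume "F \<in> Fpow X"
    then have m: "\<exists>m. F \<subseteq> U n m" for n using U by (auto simp: Fpow_def)
    show "open {h. \<exists>n. F \<subseteq> U n (h n)}"
      unfolding open_iff_cylinders
    proof
      fix h assume "h \<in> {h. \<exists>n. F \<subseteq> U n (h n)}"
      then obtain n where "F \<subseteq> U n (h n)" by blast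
      then have "\<forall>y. (\<forall>i<Suc n. y i = h i) \<longrightarrow> y \<in> {h. \<exists>n. F \<subseteq> U n (h n)}"
        by (auto intro!: exI[of _ n])
      then show "\<exists>N. \<forall>y. (\<forall>i<N. y i = h i) \<longrightarrow> y \<in> {h. \<exists>n. F \<subseteq> U n (h n)}" by blast
    qed
    show "closure {h. \<exists>n. F \<subseteq> U n (h n)} = UNIV"
      unfolding closure_eq_UNIV_iff_cylinders
    proof (intro allI)
      fix x :: "nat \<Rightarrow> nat" and N
      obtain k where "F \<subseteq> U N k" using m by blast
      then show "\<exists>h\<in>{h. \<exists>n. F \<subseteq> U n (h n)}. \<forall>i<N. h i = x i"
        by (intro bexI[of _ "x(N := k)"]) (auto intro!: exI[of _ N])
    qed
  qed
  then show ?thesis by (auto simp: Fpow_def)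
qed

lemma countable_dense_baire: "\<exists>D :: (nat \<Rightarrow> nat) set. countable D \<and> closure D = UNIV"
proof (intro exI conjI)
  let ?D = "range (\<lambda>(xs :: nat list) n. if n < length xs then xs ! n else 0)"
  show "countable ?D" by simp
  show "closure ?D = UNIV"
    unfolding closure_eq_UNIV_iff_cylinders
  proof (intro allI)
    fix x :: "nat \<Rightarrow> nat" and N
    show "\<exists>y\<in>?D. \<forall>i<N. y i = x i"
      by (rule bexI[OF _ rangeI[of _ "map x [0..<N]"]]) simp
  qed
qed

text \<open>The second clause is a form of S1 for indexed families of open sets of the whole space,
  so that all its instances can be enumerated before the sets \<open>X i\<close> exist.\<close>

lemma dominating_pair:
  assumes cov: cantor_not_small_union_of_meager
  shows "\<exists>X :: bool \<Rightarrow> (nat \<Rightarrow> nat) set.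
    (\<forall>i. closure (X i) = UNIV) \<and>
    (\<forall>i U. (\<forall>n m. open (U n m)) \<and> (\<forall>n F. finite F \<and> F \<subseteq> X i \<longrightarrow> (\<exists>m. F \<subseteq> U n m)) \<longrightarrow>
       (\<exists>h :: nat \<Rightarrow> nat. \<forall>F. finite F \<and> F \<subseteq> X i \<longrightarrow> (\<exists>n. F \<subseteq> U n (h n)))) \<and>
    (\<forall>g. \<exists>x\<in>X True. \<exists>y\<in>X False. \<forall>n. g n \<le> max (x n) (y n))"
proof -
  let ?C = "UNIV :: (nat \<Rightarrow> bool) set"
  have inf: "infinite ?C" using uncountable_cantor by (rule uncountable_infinite)
  obtain R :: "(nat \<Rightarrow> bool) rel" where R: "wf R" "trans R" "total R" "\<And>a. {b. (b, a) \<in> R} \<prec> ?C"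
    using small_wellorder by blast
  have irrefl: "(a, a) \<notin> R" for a using R(1) by simp
  obtain D :: "(nat \<Rightarrow> nat) set" where D: "countable D" "closure D = UNIV"
    using countable_dense_baire by blast
  obtain U :: "(nat \<Rightarrow> bool) \<Rightarrow> nat \<Rightarrow> nat \<Rightarrow> (nat \<Rightarrow> nat) set"
    where U: "\<And>a n m. open (U a n m)" "\<And>V. (\<forall>n m. open (V n m)) \<Longrightarrow> \<exists>a. U a = V"
    using open_double_sequences_enumeration by blast

  \<comment> \<open>The value \<open>f a i\<close> is the pair of the point added to the \<open>i\<close>-th set at stage \<open>a\<close> and the selector for \<open>U a\<close>.\<close>
  define X where "X f i a = D \<union> (\<lambda>b. fst (f b i)) ` {b. (b, a) \<in> R}"
    for f :: "(nat \<Rightarrow> bool) \<Rightarrow> bool \<Rightarrow> (nat \<Rightarrow> nat) \<times> (nat \<Rightarrow> nat)" and i a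
  \<comment> \<open>Only finite subsets of the stage set have to be captured. A sequence suitable
    for the final set is therefore good at its own stage.\<close>
  define good where "good f i a \<longleftrightarrow> (\<forall>n F. finite F \<and> F \<subseteq> X f i a \<longrightarrow> (\<exists>m. F \<subseteq> U a n m))" for f i a
  define sel where "sel f i b n = U b n (snd (f b i) n)"
    for f :: "(nat \<Rightarrow> bool) \<Rightarrow> bool \<Rightarrow> (nat \<Rightarrow> nat) \<times> (nat \<Rightarrow> nat)" and i b n
  \<comment> \<open>First clause: for every sequence treated so far, the new point can join any
    finite set of earlier points inside one selected set. Second clause: since
    \<open>first_true\<close> is surjective, the stages run through all functions to be
    dominated.\<close>
  define Q where "Q f a \<longleftrightarrow>
      (\<forall>i b. (b = a \<or> (b, a) \<in> R) \<and> good f i b \<longrightarrow>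
         (\<forall>F. finite F \<and> F \<subseteq> X f i a \<longrightarrow> (\<exists>n. insert (fst (f a i)) F \<subseteq> sel f i b n))) \<and>
      (\<forall>n. first_true a n \<le> max (fst (f a True) n) (fst (f a False) n))" for f a

  \<comment> \<open>This and the next two facts show that \<open>Q f a\<close> depends only on the
    values of \<open>f\<close> at and below \<open>a\<close>, as well-founded choice
    requires.\<close>
  have X_cong: "X f i b = X g i b" if "\<And>z. (z, a) \<in> R \<Longrightarrow> f z = g z" "b = a \<or> (b, a) \<in> R" for f g i a b
  proof -
    have "(z, b) \<in> R \<Longrightarrow> f z = g z" for z using that R(2) by (metis transD)
    then show ?thesis unfolding X_def by (auto simp: image_iff)
  qed
  have good_cong: "good f i b = good g i b" if "\<And>z. (z, a) \<in> R \<Longrightarrow> f z = g z" "b = a \<or> (b, a) \<in> R" for f g i a b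
    unfolding good_def by (simp add: X_cong[OF that])
  have Q_cong: "Q f a = Q g a" if "\<And>z. (z, a) \<in> R \<Longrightarrow> f z = g z" "f a = g a" for f g a
  proof -
    have "sel f i b = sel g i b" if "b = a \<or> (b, a) \<in> R" for i b
    proof -
      have "f b = g b" using that \<open>f a = g a\<close> \<open>\<And>z. (z, a) \<in> R \<Longrightarrow> f z = g z\<close> by blast
      then show ?thesis unfolding sel_def by simp
    qed
    then show ?thesis
      unfolding Q_def using X_cong[of a f g a] good_cong[of a f g] that by (simp cong: conj_cong)
  qed

  have QD: "\<exists>n. insert (fst (f a i)) F \<subseteq> sel f i b n"
    if "Q f a" "b = a \<or> (b, a) \<in> R" "good f i b" "finite F" "F \<subseteq> X f i a" for f a i b F
  proof -
    from that(1) have "\<forall>i b. (b = a \<or> (b, a) \<in> R) \<and> good f i b \<longrightarrow>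
         (\<forall>F. finite F \<and> F \<subseteq> X f i a \<longrightarrow> (\<exists>n. insert (fst (f a i)) F \<subseteq> sel f i b n))"
      unfolding Q_def by (rule conjunct1)
    from this[rule_format, of b i F] that(2-5) show ?thesis by simp
  qed
  \<comment> \<open>Look at the greatest stage \<open>m\<close> contributing to \<open>F\<close>. If
    it precedes \<open>a\<close>, the selector of stage \<open>a\<close> already handles
    \<open>F\<close>; otherwise \<open>Q f m\<close> adds the point of stage \<open>m\<close> to the
    rest of \<open>F\<close>. The set \<open>J\<close> is an initial segment during the recursion
    and everything at the end.\<close>
  have covers: "\<exists>n. F \<subseteq> sel f i a n"
    if a: "Q f a" "good f i a" and J: "\<And>b. b \<in> J \<Longrightarrow> Q f b"
      and F: "finite F" "F \<subseteq> D \<union> (\<lambda>b. fst (f b i)) ` J" for f a i J F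
  proof -
    have "finite (F - D)" "F - D \<subseteq> (\<lambda>b. fst (f b i)) ` J" using F by blast+
    then obtain K where K: "finite K" "K \<subseteq> J" "F - D = (\<lambda>b. fst (f b i)) ` K"
      by (meson finite_subset_image)
    have below: "\<exists>n. F \<subseteq> sel f i a n" if "F \<subseteq> X f i a"
      using QD[OF a(1) _ a(2) F(1) that] by auto
    show ?thesis
    proof (cases "K = {}")
      case True
      then show ?thesis using K below by (auto simp: X_def)
    next
      case False
      then obtain m where m: "m \<in> K" "\<And>b. b \<in> K \<Longrightarrow> b = m \<or> (b, m) \<in> R"
        using finite_has_greatest[OF K(1) False R(2,3)] by blast
      show ?thesis
      proof (cases "(m, a) \<in> R")
        case True
        then have "(b, a) \<in> R" if "b \<in> K" for b using m(2)[OF that] R(2) by (metis transD)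
        then have "F \<subseteq> X f i a" using K(3) unfolding X_def by blast
        then show ?thesis by (rule below)
      next
        case False
        then have "a = m \<or> (a, m) \<in> R" using R(3) unfolding total_on_def by blast
        moreover have "F - {fst (f m i)} \<subseteq> X f i m" using K(3) m(2) unfolding X_def by blast
        moreover have "Q f m" using J K(2) m(1) by blast
        ultimately have "\<exists>n. insert (fst (f m i)) (F - {fst (f m i)}) \<subseteq> sel f i a n"
          using a(2) F(1) by (intro QD) auto
        then show ?thesis by blast
      qed
    qed
  qed

  have step: "\<exists>r. Q (f(a := r)) a" if IH: "\<And>b. (b, a) \<in> R \<Longrightarrow> Q f b" for f a
  proof -
    have smallX: "X f i a \<prec> ?C" for i
    proof -
      have "D \<prec> ?C" using D(1) uncountable_cantor by (rule countable_lesspoll_uncountable)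
      moreover have "(\<lambda>b. fst (f b i)) ` {b. (b, a) \<in> R} \<prec> ?C"
        by (rule lesspoll_trans1[OF image_lepoll R(4)])
      ultimately show ?thesis unfolding X_def by (rule Un_lesspoll_infinite[OF _ _ inf])
    qed
    have "\<exists>h :: nat \<Rightarrow> nat. good f i a \<longrightarrow> (\<forall>F. finite F \<and> F \<subseteq> X f i a \<longrightarrow> (\<exists>n. F \<subseteq> U a n (h n)))" for i
      using small_selection[OF cov smallX[of i], of "U a"] unfolding good_def by blast
    then obtain h :: "bool \<Rightarrow> nat \<Rightarrow> nat" where
      h: "\<And>i F. good f i a \<Longrightarrow> finite F \<Longrightarrow> F \<subseteq> X f i a \<Longrightarrow> \<exists>n. F \<subseteq> U a n (h i n)"
      by metis
    \<comment> \<open>The selected sets as they will be once stage \<open>a\<close> is filled in: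
      the selector for \<open>b = a\<close> is the new \<open>h i\<close>, not yet stored in
      \<open>f\<close>.\<close>
    define S where "S i b n = U b n (if b = a then h i n else snd (f b i) n)" for i b n
    define B where "B = {b. b = a \<or> (b, a) \<in> R}"
    have S_covers: "\<exists>n. F \<subseteq> S i b n" if "b \<in> B" "good f i b" "finite F" "F \<subseteq> X f i a" for i b F
    proof (cases "b = a")
      case True
      then show ?thesis using h that by (auto simp: S_def)
    next
      case False
      then have "(b, a) \<in> R" using that(1) by (simp add: B_def)
      then have "\<exists>n. F \<subseteq> sel f i b n"
        using covers[of f b i "{c. (c, a) \<in> R}" F] IH that by (auto simp: X_def)
      then show ?thesis using False by (simp add: S_def sel_def)
    qed
    define G where "G i b F = \<Union>{S i b n | n. F \<subseteq> S i b n}" for i b F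
    have G_open: "open (G i b F)" for i b F by (auto simp: G_def S_def U)
    have G_dense: "closure (G i b F) = UNIV" if "b \<in> B" "good f i b" "finite F" "F \<subseteq> X f i a" for i b F
    proof -
      \<comment> \<open>\<open>D\<close> is part of every stage set, so \<open>insert d F\<close> is
        again a finite subset of it and is captured.\<close>
      have "D \<subseteq> G i b F"
      proof
        fix d assume "d \<in> D"
        then have "\<exists>n. insert d F \<subseteq> S i b n"
          using that by (intro S_covers) (auto simp: X_def)
        then show "d \<in> G i b F" by (auto simp: G_def)
      qed
      then show ?thesis using D(2) closure_mono by blast
    qed
    define T where "T = (\<lambda>(x :: nat \<Rightarrow> nat) n. reflect (first_true a n) (x n))"
    define I where "I = (UNIV :: bool set) \<times> B \<times> Fpow (X f True a \<union> X f False a)"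
    \<comment> \<open>The requirements on both new points become requirements on the single point
      \<open>x\<close>; those on the second are pulled back along \<open>T\<close>. Triples that
      impose nothing get the whole space.\<close>
    define H where "H = (\<lambda>(i, b, F). if good f i b \<and> F \<subseteq> X f i a
      then (if i then G i b F else T -` G i b F) else UNIV)"
    have "B = insert a {b. (b, a) \<in> R}" by (auto simp: B_def)
    then have "B \<prec> ?C"
      using Un_lesspoll_infinite[OF finite_lesspoll_infinite[OF inf] R(4)[of a] inf, of "{a}"] by simp
    then have smallI: "I \<prec> ?C"
      unfolding I_def using inf smallX
      by (intro Times_lesspoll_infinite Fpow_lesspoll_infinite Un_lesspoll_infinite
          finite_lesspoll_infinite[OF inf finite]) auto
    have "\<exists>x. \<forall>p\<in>I. x \<in> H p"
    proof (rule baire_small_intersection[OF cov smallI])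
      fix p assume "p \<in> I"
      then obtain i b F where p: "p = (i, b, F)" "b \<in> B" "finite F" by (auto simp: I_def Fpow_def)
      have "open (T -` G i b F)" for i
        unfolding T_def using continuous_on_coordinatewise_discrete G_open
        by (intro open_vimage) auto
      then show "open (H p)" using G_open unfolding H_def p by simp
      show "closure (H p) = UNIV"
        using G_dense[OF p(2) _ p(3)] dense_reflect_vimage[of _ "first_true a", folded T_def]
        unfolding H_def p by simp
    qed
    then obtain x where x: "\<And>p. p \<in> I \<Longrightarrow> x \<in> H p" by blast
    define r where "r i = (if i then x else T x, h i)" for i
    let ?f = "f(a := r)"
    have f_eq: "?f z = f z" if "(z, a) \<in> R" for z using that irrefl by auto
    have "Q ?f a"
      unfolding Q_def
    proof (intro conjI allI impI)
      fix i b F assume b: "(b = a \<or> (b, a) \<in> R) \<and> good ?f i b" and F: "finite F \<and> F \<subseteq> X ?f i a"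
      have gb: "good f i b" using b good_cong[of a ?f f b i] f_eq by blast
      have FX: "F \<subseteq> X f i a" using F X_cong[of a ?f f a i] f_eq by blast
      have "(i, b, F) \<in> I" using b F FX by (cases i) (auto simp: I_def B_def Fpow_def)
      from x[OF this] have "fst (r i) \<in> G i b F" using gb FX by (cases i) (auto simp: H_def r_def)
      then obtain n where "insert (fst (r i)) F \<subseteq> S i b n" by (auto simp: G_def)
      moreover have "S i b n = sel ?f i b n" by (auto simp: S_def sel_def r_def)
      ultimately show "\<exists>n. insert (fst (?f a i)) F \<subseteq> sel ?f i b n" by auto
    next
      show "first_true a n \<le> max (fst (?f a True) n) (fst (?f a False) n)" for n
        using le_max_reflect by (simp add: r_def T_def)
    qed
    then show ?thesis by blast
  qed

  have "\<exists>f. \<forall>a. Q (f(a := f a)) a"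
  proof (rule dependent_wf_choice[OF R(1), of "\<lambda>f a r. Q (f(a := r)) a"])
    fix f g :: "(nat \<Rightarrow> bool) \<Rightarrow> bool \<Rightarrow> (nat \<Rightarrow> nat) \<times> (nat \<Rightarrow> nat)" and a r
    assume "\<And>z. (z, a) \<in> R \<Longrightarrow> f z = g z"
    then show "Q (f(a := r)) a = Q (g(a := r)) a" by (intro Q_cong) auto
  next
    fix a f assume "\<And>b. (b, a) \<in> R \<Longrightarrow> Q (f(b := f b)) b"
    then show "\<exists>r. Q (f(a := r)) a" by (intro step) simp
  qed
  then obtain f where f: "\<And>a. Q f a" by auto
  define Y where "Y i = D \<union> range (\<lambda>b. fst (f b i))" for i
  show ?thesis
  proof (intro exI[of _ Y] conjI allI impI)
    show "closure (Y i) = UNIV" for i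
      using D(2) closure_mono[of D "Y i"] by (auto simp: Y_def)
  next
    fix i and V :: "nat \<Rightarrow> nat \<Rightarrow> (nat \<Rightarrow> nat) set"
    assume V: "(\<forall>n m. open (V n m)) \<and> (\<forall>n F. finite F \<and> F \<subseteq> Y i \<longrightarrow> (\<exists>m. F \<subseteq> V n m))"
    from U(2)[OF conjunct1[OF V]] obtain a where a: "U a = V" by (rule exE)
    have "X f i a \<subseteq> Y i" by (auto simp: X_def Y_def)
    then have good: "good f i a" using conjunct2[OF V] unfolding good_def a by (meson order_trans)
    have "\<exists>n. F \<subseteq> V n (snd (f a i) n)" if "finite F" "F \<subseteq> Y i" for F
      using covers[OF f good f that(1), of UNIV] that(2) by (simp add: Y_def sel_def a)
    then show "\<exists>h :: nat \<Rightarrow> nat. \<forall>F. finite F \<and> F \<subseteq> Y i \<longrightarrow> (\<exists>n. F \<subseteq> V n (h n))" by blast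
  next
    fix g
    obtain a where "g = first_true a" using surj_first_true by (metis surjD)
    then have "\<forall>n. g n \<le> max (fst (f a True) n) (fst (f a False) n)"
      using f[of a] by (simp add: Q_def)
    then show "\<exists>x\<in>Y True. \<exists>y\<in>Y False. \<forall>n. g n \<le> max (x n) (y n)"
      by (auto simp: Y_def)
  qed
qed

section \<open>Covering properties of the images\<close>

text \<open>Cover members are extended to open sets of the ambient space and pulled back along
  \<open>E\<close>, where the selection hypothesis applies. The selected family omits the whole set
  because each given cover does.\<close>

lemma S1_omega_covers_continuous_image:
  fixes E :: "'a::topological_space \<Rightarrow> 'b::topological_space"
  assumes E: "continuous_on UNIV E"
    and sel: "\<And>U :: nat \<Rightarrow> nat \<Rightarrow> 'a set. (\<And>n m. open (U n m)) \<Longrightarrow>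
      (\<And>n F. finite F \<Longrightarrow> F \<subseteq> X \<Longrightarrow> \<exists>m. F \<subseteq> U n m) \<Longrightarrow>
      \<exists>h :: nat \<Rightarrow> nat. \<forall>F. finite F \<and> F \<subseteq> X \<longrightarrow> (\<exists>n. F \<subseteq> U n (h n))"
  shows "S1 (omega_covers (E ` X)) (omega_covers (E ` X))"
  unfolding S1_def
proof (intro allI impI)
  fix \<U> :: "nat \<Rightarrow> 'b set set"
  assume \<U>: "\<forall>n. \<U> n \<in> omega_covers (E ` X)"
  have count: "countable (\<U> n)" and opn: "\<And>U. U \<in> \<U> n \<Longrightarrow> openin (top_of_set (E ` X)) U"
    and notin: "E ` X \<notin> \<U> n"
    and fin: "\<And>F. finite F \<Longrightarrow> F \<subseteq> E ` X \<Longrightarrow> \<exists>U\<in>\<U> n. F \<subseteq> U" for n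
    using \<U> by (auto simp: omega_covers_def countable_open_cover_def)
  have ne: "\<U> n \<noteq> {}" for n using fin[of "{}" n] by auto
  define u where "u n m = from_nat_into (\<U> n) m" for n m
  have u_in: "u n m \<in> \<U> n" for n m unfolding u_def by (rule from_nat_into[OF ne])
  have u_onto: "\<exists>m. u n m = U" if "U \<in> \<U> n" for n U
    unfolding u_def using from_nat_into_surj[OF count that] .
  have "\<exists>V. open V \<and> u n m = E ` X \<inter> V" for n m
    using opn[OF u_in] unfolding openin_open by blast
  then obtain V where V: "\<And>n m. open (V n m)" "\<And>n m. u n m = E ` X \<inter> V n m" by metis
  have "\<exists>h :: nat \<Rightarrow> nat. \<forall>F. finite F \<and> F \<subseteq> X \<longrightarrow> (\<exists>n. F \<subseteq> E -` V n (h n))"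
  proof (rule sel)
    show "open (E -` V n m)" for n m using V(1) E by (intro open_vimage)
    fix n F assume "finite F" "F \<subseteq> X"
    then obtain U where "U \<in> \<U> n" "E ` F \<subseteq> U" using fin[of "E ` F" n] by blast
    then obtain m where "E ` F \<subseteq> u n m" using u_onto by blast
    then show "\<exists>m. F \<subseteq> E -` V n m" using V(2) by blast
  qed
  then obtain h :: "nat \<Rightarrow> nat" where h: "\<forall>F. finite F \<and> F \<subseteq> X \<longrightarrow> (\<exists>n. F \<subseteq> E -` V n (h n))"
    by (rule exE)
  let ?W = "{u n (h n) | n. True}"
  have W_fin: "\<exists>U\<in>?W. F \<subseteq> U" if F: "finite F" "F \<subseteq> E ` X" for F
  proof -
    obtain C where C: "C \<subseteq> X" "finite C" "F = E ` C" using finite_subset_image[OF F] by blast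
    then obtain n where "C \<subseteq> E -` V n (h n)" using h[rule_format, of C] by auto
    then have "F \<subseteq> u n (h n)" using C V(2) by blast
    then show ?thesis by blast
  qed
  have "?W \<in> omega_covers (E ` X)"
    unfolding omega_covers_def countable_open_cover_def
  proof (intro CollectI conjI allI impI)
    have "?W = range (\<lambda>n. u n (h n))" by blast
    then show "countable ?W" by simp
    show "\<forall>U\<in>?W. openin (top_of_set (E ` X)) U" using opn u_in by blast
    show "E ` X \<notin> ?W"
    proof
      assume "E ` X \<in> ?W"
      then obtain n where "E ` X = u n (h n)" by blast
      then show False using notin[of n] u_in[of n "h n"] by simp
    qed
    show "\<Union>?W = E ` X"
    proof
      show "\<Union>?W \<subseteq> E ` X" using V(2) by blast
      show "E ` X \<subseteq> \<Union>?W"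
      proof
        fix y assume "y \<in> E ` X"
        then have "\<exists>U\<in>?W. {y} \<subseteq> U" by (intro W_fin) auto
        then show "y \<in> \<Union>?W" by blast
      qed
    qed
    show "\<exists>U\<in>?W. F \<subseteq> U" if "finite F \<and> F \<subseteq> E ` X" for F
      using that by (intro W_fin) auto
  qed
  then show "\<exists>U. (\<forall>n. U n \<in> \<U> n) \<and> {U n |n. True} \<in> omega_covers (E ` X)"
    using u_in by (intro exI[of _ "\<lambda>n. u n (h n)"]) blast
qed

text \<open>The sets \<open>A n m\<close> increase with \<open>m\<close>, so a finite choice from
  each cover amounts to a bound \<open>g n\<close>. A pair whose maximum exceeds \<open>g\<close>
  everywhere is contained in none of the resulting unions.\<close>

lemma not_Ufin_dominating_pairs:
  fixes E :: "(nat \<Rightarrow> nat) \<Rightarrow> 'b::metric_space"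
  assumes sep: "\<And>n k. \<exists>e>0. \<forall>f g. f n = k \<longrightarrow> dist (E g) (E f) < e \<longrightarrow> g n = k"
    and unbounded: "\<And>n k. \<exists>f\<in>X. f n = k"
    and dom: "\<And>g. \<exists>x\<in>X. \<exists>y\<in>X. \<forall>n. g n \<le> max (x n) (y n)"
  shows "\<not> Ufin (E ` X) (gamma_covers (E ` X)) (omega_covers (E ` X))"
proof
  assume ufin: "Ufin (E ` X) (gamma_covers (E ` X)) (omega_covers (E ` X))"
  have same: "f n = g n" if "E f = E g" for f g n
    using sep[of n "g n"] that by (metis dist_self)
  define A where "A n m = E ` {f \<in> X. f n \<le> m}" for n m
  have in_A: "E f \<in> A n m \<longleftrightarrow> f n \<le> m" if "f \<in> X" for f n m
    using that same by (fastforce simp: A_def)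
  have bounded: "\<exists>m. \<Union>\<V> \<subseteq> A n m" if \<V>: "finite \<V>" "\<V> \<subseteq> range (A n)" for \<V> n
  proof -
    obtain K where K: "finite K" "\<V> = A n ` K" using \<V> by (meson finite_subset_image)
    have "A n k \<subseteq> A n (Max K)" if "k \<in> K" for k
      using Max_ge[OF K(1) that] by (auto simp: A_def)
    then show ?thesis using K by blast
  qed
  have A_not_all: "\<exists>f\<in>X. E f \<notin> A n m" for n m
  proof -
    obtain f where "f \<in> X" "f n = Suc m" using unbounded by metis
    then show ?thesis using in_A[of f n m] by auto
  qed
  have A_open: "openin (top_of_set (E ` X)) (A n m)" for n m
    unfolding openin_euclidean_subtopology_iff
  proof (intro conjI ballI)
    show "A n m \<subseteq> E ` X" by (auto simp: A_def)
    fix y assume "y \<in> A n m"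
    then obtain f where f: "f \<in> X" "f n \<le> m" "y = E f" by (auto simp: A_def)
    obtain e where "e > 0" "\<And>g. dist (E g) (E f) < e \<Longrightarrow> g n = f n" using sep[of n "f n"] by blast
    then show "\<exists>e>0. \<forall>x'\<in>E ` X. dist x' y < e \<longrightarrow> x' \<in> A n m"
      using f in_A by (intro exI[of _ e]) auto
  qed
  have gamma: "range (A n) \<in> gamma_covers (E ` X)" for n
    unfolding gamma_covers_def countable_open_cover_def
  proof (intro CollectI conjI ballI)
    show "countable (range (A n))" by simp
    show "openin (top_of_set (E ` X)) U" if "U \<in> range (A n)" for U using that A_open by blast
    show "\<Union>(range (A n)) = E ` X" by (auto simp: A_def)
    \<comment> \<open>Infinitely many indices must give infinitely many sets; this holds because
      coordinate \<open>n\<close> takes every value on \<open>X\<close>.\<close>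
    have "inj (A n)"
    proof (rule injI)
      fix k m assume eq: "A n k = A n m"
      obtain f g where "f \<in> X" "f n = k" "g \<in> X" "g n = m" using unbounded by metis
      then show "k = m" using eq in_A[of f n] in_A[of g n] by (metis order_antisym order_refl)
    qed
    then show "infinite (range (A n))" using finite_imageD by blast
    fix y assume "y \<in> E ` X"
    then obtain f where f: "f \<in> X" "y = E f" by blast
    have "{U \<in> range (A n). y \<notin> U} \<subseteq> A n ` {..<f n}"
      using f in_A by (auto simp: not_le)
    then show "finite {U \<in> range (A n). y \<notin> U}" by (rule finite_subset) simp
  qed
  have no_finite: "\<not> (\<exists>\<V>. finite \<V> \<and> \<V> \<subseteq> range (A n) \<and> \<Union>\<V> = E ` X)" for n
  proof
    assume "\<exists>\<V>. finite \<V> \<and> \<V> \<subseteq> range (A n) \<and> \<Union>\<V> = E ` X"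
    then obtain m where "E ` X \<subseteq> A n m" using bounded by metis
    then show False using A_not_all by blast
  qed
  have "\<forall>n. range (A n) \<in> gamma_covers (E ` X) \<and>
      \<not> (\<exists>\<V>. finite \<V> \<and> \<V> \<subseteq> range (A n) \<and> \<Union>\<V> = E ` X)"
    using gamma no_finite by (intro allI conjI)
  from mp[OF spec[OF ufin[unfolded Ufin_def], of "\<lambda>n. range (A n)"] this]
  obtain \<V> where \<V>: "\<forall>n. finite (\<V> n) \<and> \<V> n \<subseteq> range (A n)"
      "{\<Union>(\<V> n) | n. True} \<in> omega_covers (E ` X)"
    by (elim exE conjE)
  have "\<exists>m. \<Union>(\<V> n) \<subseteq> A n m" for n using \<V>(1) by (intro bounded) auto
  then obtain g where g: "\<And>n. \<Union>(\<V> n) \<subseteq> A n (g n)" by metis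
  \<comment> \<open>Dominating \<open>Suc (g n)\<close> makes the excess over \<open>g\<close>
    strict.\<close>
  obtain x y where xy: "x \<in> X" "y \<in> X" "\<And>n. Suc (g n) \<le> max (x n) (y n)" using dom[of "\<lambda>n. Suc (g n)"] by blast
  have "\<forall>F. finite F \<and> F \<subseteq> E ` X \<longrightarrow> (\<exists>W\<in>{\<Union>(\<V> n) | n. True}. F \<subseteq> W)"
    using \<V>(2) unfolding omega_covers_def by simp
  from this[rule_format, of "{E x, E y}"] xy(1,2)
  obtain n where n: "{E x, E y} \<subseteq> \<Union>(\<V> n)" by auto
  have "x n \<le> g n" "y n \<le> g n"
    using subset_trans[OF n g[of n]] in_A[OF xy(1)] in_A[OF xy(2)] by simp_all
  then show False using xy(3)[of n] by simp
qed

theorem theorem3p1: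
  assumes "cantor_not_small_union_of_meager"
  shows "\<exists>X\<^sub>1 X\<^sub>2 :: real set.
    set_of_reals X\<^sub>1 \<and> set_of_reals X\<^sub>2 \<and>
    S1 (omega_covers X\<^sub>1) (omega_covers X\<^sub>1) \<and>
    S1 (omega_covers X\<^sub>2) (omega_covers X\<^sub>2) \<and>
    \<not> Ufin (X\<^sub>1 \<union> X\<^sub>2) (gamma_covers (X\<^sub>1 \<union> X\<^sub>2)) (omega_covers (X\<^sub>1 \<union> X\<^sub>2))"
proof -
  obtain X :: "bool \<Rightarrow> (nat \<Rightarrow> nat) set" where
    dense: "\<And>i. closure (X i) = UNIV" and
    sel: "\<And>i U. (\<forall>n m. open (U n m)) \<and> (\<forall>n F. finite F \<and> F \<subseteq> X i \<longrightarrow> (\<exists>m. F \<subseteq> U n m)) \<Longrightarrow>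
       \<exists>h :: nat \<Rightarrow> nat. \<forall>F. finite F \<and> F \<subseteq> X i \<longrightarrow> (\<exists>n. F \<subseteq> U n (h n))" and
    dom: "\<And>g. \<exists>x\<in>X True. \<exists>y\<in>X False. \<forall>n. g n \<le> max (x n) (y n)"
    using dominating_pair[OF assms] by metis
  obtain E :: "(nat \<Rightarrow> nat) \<Rightarrow> real" where E: "continuous_on UNIV E" "range E \<inter> \<rat> = {}"
      "\<And>n k. \<exists>e>0. \<forall>f g. f n = k \<longrightarrow> dist (E g) (E f) < e \<longrightarrow> g n = k"
    using baire_space_embedding_irrationals by blast
  have S1: "S1 (omega_covers (E ` X i)) (omega_covers (E ` X i))" for i
    using E(1) by (rule S1_omega_covers_continuous_image) (rule sel, blast)
  \<comment> \<open>Density gives a point starting with \<open>n + 1\<close> copies of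
    \<open>k\<close>; this makes the bounded-coordinate covers infinite and without finite
    subcovers.\<close>
  have onto: "\<exists>f\<in>X True \<union> X False. f n = k" for n k
  proof -
    obtain f where "f \<in> X True" "\<forall>i<Suc n. f i = k"
      using dense[of True, unfolded closure_eq_UNIV_iff_cylinders, rule_format, of "Suc n" "\<lambda>_. k"] by blast
    then show ?thesis by blast
  qed
  have "\<exists>x\<in>X True \<union> X False. \<exists>y\<in>X True \<union> X False. \<forall>n. g n \<le> max (x n) (y n)" for g
    using dom[of g] by blast
  with E(3) onto have "\<not> Ufin (E ` (X True \<union> X False)) (gamma_covers (E ` (X True \<union> X False)))
      (omega_covers (E ` (X True \<union> X False)))"
    by (rule not_Ufin_dominating_pairs)
  then show ?thesis
    using S1 E(2) unfolding set_of_reals_def image_Un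
    by (intro exI[of _ "E ` X True"] exI[of _ "E ` X False"] conjI) auto
qed

end
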